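(* Let $\mathcal{S}=S_1,S_2,\ldots,S_n$ be an ensemble of labeled stub-stars. Then $\mathcal{S}$ has a caterpillar realization if and only if it is forest realizable, the sum of the degrees of the stub-stars is $2n-2$, and there is no labeled stub-star in $\mathcal{S}$ with more than two labels larger than $1$.
   Context: A labeled stub-star is a vertex with some number $d$ of stubs (half-edges), each stub labeled by a positive integer; $d$ is its degree. An ensemble is a finite multiset $\mathcal{S}=\{S_1,\ldots,S_n\}$ of labeled stub-stars. A graph $G$ on vertices $v_1,\ldots,v_n$ is a realization of $\mathcal{S}$ if for each $i$ the multiset of degrees of the neighbors of $v_i$ equals the multiset of labels of $S_i$; in particular $d(v_i)$ is the degree of $S_i$. $\mathcal{S}$ is forest realizable if it has a realization that is a forest. A caterpillar is a tree in which the non-leaf vertices form a path (the empty set and a single vertex are allowed as paths). *)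

theory Defs
  imports "HOL-Library.Multiset" "Graph_Theory.Digraph_Component"
begin

text \<open>A finite simple undirected graph is a \<^locale>\<open>pair_graph\<close>: a finite, loop-free digraph
  without parallel arcs whose arc relation is symmetric. Each undirected edge is thus a pair of
  opposite arcs, and the degree of a vertex is its out-degree.\<close>

abbreviation degree :: "'a pair_pre_digraph \<Rightarrow> 'a \<Rightarrow> nat" where
  "degree G v \<equiv> out_degree (with_proj G) v"

text \<open>For symmetric digraphs the library's \<^const>\<open>pre_digraph.cycle\<close> includes the
  back-and-forth traversal of a single edge, so its \<^const>\<open>forest\<close> is not the undirected notion.
  The cycles of an undirected graph are those of length at least three.\<close>

definition undirected_cycle :: "'a pair_pre_digraph \<Rightarrow> ('a \<times> 'a) awalk \<Rightarrow> bool" where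
  "undirected_cycle G p \<longleftrightarrow> pre_digraph.cycle (with_proj G) p \<and> 3 \<le> length p"

definition undirected_forest :: "'a pair_pre_digraph \<Rightarrow> bool" where
  "undirected_forest G \<longleftrightarrow> pair_graph G \<and> (\<nexists>p. undirected_cycle G p)"

text \<open>\<^const>\<open>connected\<close> requires at least one vertex, so the empty graph is a forest but not a
  tree.\<close>

definition undirected_tree :: "'a pair_pre_digraph \<Rightarrow> bool" where
  "undirected_tree G \<longleftrightarrow> undirected_forest G \<and> connected (with_proj G)"

text \<open>The list may be empty or a singleton.\<close>

definition path_graph :: "('a, 'b) pre_digraph \<Rightarrow> bool" where
  "path_graph H \<longleftrightarrow> (\<exists>xs. distinct xs \<and> verts H = set xs \<and>
     arcs_ends H = {(xs ! i, xs ! j) | i j.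
       i < length xs \<and> j < length xs \<and> (j = Suc i \<or> i = Suc j)})"

definition leaf :: "'a pair_pre_digraph \<Rightarrow> 'a \<Rightarrow> bool" where
  "leaf G v \<longleftrightarrow> v \<in> pverts G \<and> degree G v = 1"

definition caterpillar :: "'a pair_pre_digraph \<Rightarrow> bool" where
  "caterpillar G \<longleftrightarrow> undirected_tree G \<and>
     path_graph (with_proj G \<restriction> {v \<in> pverts G. \<not> leaf G v})"

text \<open>A labeled stub-star is the multiset of its labels; its degree is the size of that multiset.
  An ensemble is given by an enumeration \<open>S 1, \<dots>, S n\<close>.\<close>

type_synonym stub_star = "nat multiset"

definition ensemble :: "nat \<Rightarrow> (nat \<Rightarrow> stub_star) \<Rightarrow> bool" where
  "ensemble n S \<longleftrightarrow> (\<forall>i\<in>{1..n}. \<forall>l\<in>#S i. 0 < l)"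

definition neighbour_degrees :: "'a pair_pre_digraph \<Rightarrow> 'a \<Rightarrow> nat multiset" where
  "neighbour_degrees G v = {#degree G w. w \<in># mset_set {w. (v, w) \<in> parcs G}#}"

text \<open>The vertex \<open>v\<^sub>i\<close> is the number \<open>i\<close>.\<close>

definition realization :: "nat pair_pre_digraph \<Rightarrow> nat \<Rightarrow> (nat \<Rightarrow> stub_star) \<Rightarrow> bool" where
  "realization G n S \<longleftrightarrow> pair_graph G \<and> pverts G = {1..n} \<and>
     (\<forall>i\<in>{1..n}. neighbour_degrees G i = S i)"

definition forest_realizable :: "nat \<Rightarrow> (nat \<Rightarrow> stub_star) \<Rightarrow> bool" where
  "forest_realizable n S \<longleftrightarrow> (\<exists>G. realization G n S \<and> undirected_forest G)"

end

theory Submission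
  imports Defs
begin

text \<open>
  No rewiring of the realization is needed: a forest realization that satisfies the two numerical
  conditions is already a caterpillar, and conversely (\<open>caterpillar_realization_iff\<close>).

  The stub-star degrees are the vertex degrees of any realization, so their sum is twice the number
  of edges. A forest on \<open>n \<ge> 1\<close> vertices has at most \<open>n - 1\<close> edges, with equality exactly when it
  is connected (\<open>forest_card_edges\<close>); the condition \<open>2n - 2\<close> therefore says that the forest is a
  tree. The labels larger than \<open>1\<close> at a stub-star count the non-leaf neighbours of its vertex, so
  the last condition says that every vertex has at most two of them. In a tree this makes the
  subgraph on the non-leaves a path: deleting leaves does not disconnect the others
  (\<open>rtrancl_avoiding_leaves\<close>), and a connected graph without cycles and with maximum degree two is
  a path (\<open>path_graph_if_degree_le_2\<close>). Conversely, a vertex of a path has at most two neighbours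
  on it, and a leaf has only one neighbour at all.

  Both the edge count and the path structure rest on a longest path: all neighbours of an end of it
  lie on it, and absence of cycles forbids chords.
\<close>

section \<open>Paths and cycles in a symmetric relation\<close>

definition vertex_path :: "'a rel \<Rightarrow> 'a list \<Rightarrow> bool" where
  "vertex_path E xs \<longleftrightarrow> distinct xs \<and> successively (\<lambda>x y. (x, y) \<in> E) xs"

definition cycle_free :: "'a rel \<Rightarrow> bool" where
  "cycle_free E \<longleftrightarrow> (\<nexists>xs. vertex_path E xs \<and> 3 \<le> length xs \<and> (last xs, hd xs) \<in> E)"

lemma cycle_free_subset: "cycle_free E \<Longrightarrow> F \<subseteq> E \<Longrightarrow> cycle_free F"
  unfolding cycle_free_def vertex_path_def by (meson subsetD successively_mono)

lemma vertex_path_nth: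
  assumes "vertex_path E xs" "Suc i < length xs"
  shows "(xs ! i, xs ! Suc i) \<in> E"
  using assms by (auto simp: vertex_path_def successively_conv_nth)

text \<open>The segment of the path between the two ends of a chord would close up to a cycle; only for
  consecutive positions is it too short to be one.\<close>

lemma vertex_path_chordless:
  assumes "cycle_free E" "sym E" "vertex_path E xs" "i < j" "j < length xs"
    and chord: "(xs ! i, xs ! j) \<in> E"
  shows "j = Suc i"
proof (rule ccontr)
  assume "j \<noteq> Suc i"
  define ys where "ys = take (Suc (j - i)) (drop i xs)"
  have len: "length ys = Suc (j - i)" using assms by (simp add: ys_def)
  have nth: "ys ! k = xs ! (i + k)" if "k \<le> j - i" for k
    using that assms by (simp add: ys_def)
  have "vertex_path E ys"
    using assms nth len by (auto simp: vertex_path_def successively_conv_nth ys_def)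
  moreover have "3 \<le> length ys" using len \<open>i < j\<close> \<open>j \<noteq> Suc i\<close> by simp
  moreover have "last ys = xs ! j" "hd ys = xs ! i"
  proof -
    have "ys \<noteq> []" using len by auto
    then show "last ys = xs ! j" "hd ys = xs ! i"
      using nth[of "j - i"] nth[of 0] len \<open>i < j\<close> by (simp_all add: last_conv_nth hd_conv_nth)
  qed
  ultimately show False
    using assms(1) symD[OF assms(2) chord] unfolding cycle_free_def by metis
qed

lemma longest_vertex_path:
  assumes "finite V"
  obtains xs where "vertex_path E xs" "set xs \<subseteq> V"
    and "\<And>ys. vertex_path E ys \<Longrightarrow> set ys \<subseteq> V \<Longrightarrow> length ys \<le> length xs"
proof -
  have "vertex_path E [] \<and> set [] \<subseteq> V" by (simp add: vertex_path_def)
  moreover have "\<forall>ys. vertex_path E ys \<and> set ys \<subseteq> V \<longrightarrow> length ys < Suc (card V)"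
    using assms by (metis card_mono distinct_card vertex_path_def less_Suc_eq_le)
  ultimately show ?thesis
    using ex_has_greatest_nat[of "\<lambda>xs. vertex_path E xs \<and> set xs \<subseteq> V" "[]" length "Suc (card V)"] that
    by blast
qed

lemma vertex_path_Cons:
  assumes "vertex_path E xs" "w \<notin> set xs" "xs \<noteq> [] \<Longrightarrow> (w, hd xs) \<in> E"
  shows "vertex_path E (w # xs)"
  using assms by (auto simp: vertex_path_def successively_Cons)

lemma vertex_path_snoc:
  assumes "vertex_path E xs" "w \<notin> set xs" "xs \<noteq> [] \<Longrightarrow> (last xs, w) \<in> E"
  shows "vertex_path E (xs @ [w])"
  using assms by (auto simp: vertex_path_def successively_append_iff)

section \<open>Counting the edges of a forest\<close>

text \<open>The first vertex of a longest path is such a vertex. A neighbour off the path could be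
  prepended, and a neighbour on the path other than the second vertex would be a chord.\<close>

lemma cycle_free_low_degree_vertex:
  assumes "finite V" "V \<noteq> {}" "E \<subseteq> V \<times> V" "sym E" "irrefl E" "cycle_free E"
  obtains v where "v \<in> V" "\<And>y z. (v, y) \<in> E \<Longrightarrow> (v, z) \<in> E \<Longrightarrow> y = z"
proof -
  obtain xs where xs: "vertex_path E xs" "set xs \<subseteq> V"
    and max: "\<And>ys. vertex_path E ys \<Longrightarrow> set ys \<subseteq> V \<Longrightarrow> length ys \<le> length xs"
    using longest_vertex_path[OF \<open>finite V\<close>, of E] by blast
  obtain v where "v \<in> V" using \<open>V \<noteq> {}\<close> by blast
  then have "xs \<noteq> []" using max[of "[v]"] by (auto simp: vertex_path_def)
  have second: "w = xs ! 1" if w: "(hd xs, w) \<in> E" for w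
  proof -
    have "w \<in> set xs"
    proof (rule ccontr)
      assume "w \<notin> set xs"
      moreover have "(w, hd xs) \<in> E" using w \<open>sym E\<close> by (meson symD)
      ultimately have "vertex_path E (w # xs)" using xs(1) by (intro vertex_path_Cons)
      moreover have "set (w # xs) \<subseteq> V" using xs(2) w \<open>E \<subseteq> V \<times> V\<close> by auto
      ultimately show False using max by fastforce
    qed
    then obtain j where j: "j < length xs" "w = xs ! j" by (auto simp: in_set_conv_nth)
    then have "j \<noteq> 0" using w \<open>irrefl E\<close> \<open>xs \<noteq> []\<close> by (auto simp: irrefl_def hd_conv_nth intro: gr0I)
    then have "j = Suc 0"
      using vertex_path_chordless[OF \<open>cycle_free E\<close> \<open>sym E\<close> xs(1), of 0 j] j w \<open>xs \<noteq> []\<close>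
      by (simp add: hd_conv_nth)
    with j show ?thesis by simp
  qed
  show ?thesis
    using that[of "hd xs"] second xs(2) \<open>xs \<noteq> []\<close> by (metis hd_in_set subsetD)
qed

text \<open>A walk that enters a leaf can only go back to where it came from, so the visit can be cut
  out. The induction along the walk must also speak of walks that currently stand on a leaf: for
  these it records the unique neighbour, which has been reached without leaves.\<close>

lemma rtrancl_avoiding_leaves:
  assumes "sym E"
    and leaf: "\<And>x y z. x \<in> L \<Longrightarrow> (x, y) \<in> E \<Longrightarrow> (x, z) \<in> E \<Longrightarrow> y = z"
    and "(u, v) \<in> E\<^sup>*" "u \<notin> L" "v \<notin> L"
  shows "(u, v) \<in> (E \<inter> (- L) \<times> (- L))\<^sup>*"
proof -
  let ?R = "E \<inter> (- L) \<times> (- L)"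
  have "if v \<in> L then \<exists>z. z \<notin> L \<and> (v, z) \<in> E \<and> (u, z) \<in> ?R\<^sup>* else (u, v) \<in> ?R\<^sup>*"
    using assms(3)
  proof (induction rule: rtrancl_induct)
    case base
    then show ?case using \<open>u \<notin> L\<close> by simp
  next
    case (step y z)
    show ?case
    proof (cases "y \<in> L")
      case True
      then obtain w where "w \<notin> L" "(y, w) \<in> E" "(u, w) \<in> ?R\<^sup>*" using step.IH by auto
      then show ?thesis using leaf[OF True _ step.hyps(2)] by auto
    next
      case False
      then have "(u, y) \<in> ?R\<^sup>*" using step.IH by simp
      moreover have "(z, y) \<in> E" using step.hyps(2) \<open>sym E\<close> by (meson symD)
      ultimately show ?thesis using False step.hyps(2) by (auto intro: rtrancl_into_rtrancl)
    qed
  qed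
  with \<open>v \<notin> L\<close> show ?thesis by simp
qed

text \<open>Induction on the number of vertices, removing a vertex \<open>v\<close> of degree at most one. If it has a
  neighbour, both sides of the inequality drop by two and connectedness is unaffected. If it is
  isolated and not the only vertex, the graph is disconnected, and the inequality for the rest is
  strict by two for the whole. As \<open>E\<close> holds both orientations, \<open>card E\<close> is twice the number of
  edges.\<close>

lemma forest_card_edges:
  assumes "finite V" "V \<noteq> {}" "E \<subseteq> V \<times> V" "sym E" "irrefl E" "cycle_free E"
  shows "card E + 2 \<le> 2 * card V \<and>
    (card E + 2 = 2 * card V \<longleftrightarrow> (\<forall>u\<in>V. \<forall>v\<in>V. (u, v) \<in> E\<^sup>*))"
  using assms
proof (induction "card V" arbitrary: V E rule: less_induct)
  case less
  obtain v where v: "v \<in> V" and leaf: "\<And>y z. (v, y) \<in> E \<Longrightarrow> (v, z) \<in> E \<Longrightarrow> y = z"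
    using cycle_free_low_degree_vertex[OF less.prems] by blast
  define V' where "V' = V - {v}"
  define E' where "E' = E \<inter> (- {v}) \<times> (- {v})"
  have card_V: "card V = Suc (card V')"
    unfolding V'_def by (rule card.remove[OF less.prems(1) v])
  have "finite E" using less.prems(1,3) by (meson finite_SigmaI finite_subset)
  show ?case
  proof (cases "V' = {}")
    case True
    then have "V = {v}" using v by (auto simp: V'_def)
    then have "E = {}" using less.prems(3,5) by (auto simp: irrefl_def)
    then show ?thesis using \<open>V = {v}\<close> by simp
  next
    case False
    have IH: "card E' + 2 \<le> 2 * card V' \<and>
        (card E' + 2 = 2 * card V' \<longleftrightarrow> (\<forall>x\<in>V'. \<forall>y\<in>V'. (x, y) \<in> E'\<^sup>*))"
    proof (rule less.hyps)
      show "card V' < card V" using card_V by simp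
      show "finite V'" "E' \<subseteq> V' \<times> V'"
        using less.prems(1,3) by (auto simp: V'_def E'_def)
      show "sym E'" "irrefl E'"
        using less.prems(4,5) by (auto simp: E'_def sym_def irrefl_def)
      show "cycle_free E'"
        using less.prems(6) by (rule cycle_free_subset) (simp add: E'_def)
    qed (rule False)
    show ?thesis
    proof (cases "\<exists>w. (v, w) \<in> E")
      case False
      then have "E' = E" using less.prems(4) by (auto simp: E'_def sym_def)
      moreover have "\<not> (\<forall>x\<in>V. \<forall>y\<in>V. (x, y) \<in> E\<^sup>*)"
      proof -
        obtain u where "u \<in> V" "u \<noteq> v" using \<open>V' \<noteq> {}\<close> by (auto simp: V'_def)
        then have "(v, u) \<notin> E\<^sup>*" using False by (metis converse_rtranclE)
        with v \<open>u \<in> V\<close> show ?thesis by blast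
      qed
      ultimately show ?thesis using IH card_V by simp
    next
      case True
      then obtain w where w: "(v, w) \<in> E" by blast
      then have wv: "(w, v) \<in> E" "w \<noteq> v" "w \<in> V"
        using less.prems(3-5) by (auto simp: sym_def irrefl_def)
      have E_eq: "E = insert (v, w) (insert (w, v) E')"
        using w wv leaf less.prems(4) by (auto simp: E'_def sym_def)
      have "finite E'" using \<open>finite E\<close> by (simp add: E'_def)
      then have card_E: "card E = Suc (Suc (card E'))"
        using wv(2) by (subst E_eq) (auto simp: E'_def)
      have "(\<forall>x\<in>V. \<forall>y\<in>V. (x, y) \<in> E\<^sup>*) \<longleftrightarrow> (\<forall>x\<in>V'. \<forall>y\<in>V'. (x, y) \<in> E'\<^sup>*)"
      proof
        assume conn: "\<forall>x\<in>V. \<forall>y\<in>V. (x, y) \<in> E\<^sup>*"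
        show "\<forall>x\<in>V'. \<forall>y\<in>V'. (x, y) \<in> E'\<^sup>*"
          unfolding E'_def
          using conn leaf less.prems(4)
          by (intro ballI rtrancl_avoiding_leaves) (auto simp: V'_def)
      next
        assume conn: "\<forall>x\<in>V'. \<forall>y\<in>V'. (x, y) \<in> E'\<^sup>*"
        have sub: "E'\<^sup>* \<subseteq> E\<^sup>*" by (rule rtrancl_mono) (simp add: E'_def)
        have to_w: "(x, w) \<in> E\<^sup>* \<and> (w, x) \<in> E\<^sup>*" if "x \<in> V" for x
        proof (cases "x = v")
          case True
          then show ?thesis using w wv by auto
        next
          case False
          then have "x \<in> V'" "w \<in> V'" using that wv by (auto simp: V'_def)
          then show ?thesis using conn sub by auto
        qed
        show "\<forall>x\<in>V. \<forall>y\<in>V. (x, y) \<in> E\<^sup>*" using to_w by (meson rtrancl_trans)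
      qed
      then show ?thesis using IH card_V card_E by simp
    qed
  qed
qed

section \<open>Connected cycle-free graphs of maximum degree two\<close>

text \<open>A longest path is closed under adjacency: a further neighbour of an end would extend it, and a
  further neighbour of an interior vertex would be its third neighbour. Connectedness then
  makes the path exhaust \<open>V\<close>, and without chords its own steps are all the edges. For empty \<open>V\<close>
  the path is empty.\<close>

lemma path_graph_if_degree_le_2:
  assumes "finite V" "E \<subseteq> V \<times> V" "sym E" "irrefl E" "cycle_free E"
    and conn: "\<And>u v. u \<in> V \<Longrightarrow> v \<in> V \<Longrightarrow> (u, v) \<in> E\<^sup>*"
    and deg: "\<And>v. v \<in> V \<Longrightarrow> card (E `` {v}) \<le> 2"
  obtains xs where "distinct xs" "V = set xs"
    "E = {(xs ! i, xs ! j) | i j.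
       i < length xs \<and> j < length xs \<and> (j = Suc i \<or> i = Suc j)}"
proof -
  obtain xs where xs: "vertex_path E xs" "set xs \<subseteq> V"
    and max: "\<And>ys. vertex_path E ys \<Longrightarrow> set ys \<subseteq> V \<Longrightarrow> length ys \<le> length xs"
    using longest_vertex_path[OF \<open>finite V\<close>, of E] by blast
  have dist: "distinct xs" using xs(1) by (simp add: vertex_path_def)
  have closed: "b \<in> set xs" if a: "a \<in> set xs" and ab: "(a, b) \<in> E" for a b
  proof (rule ccontr)
    assume b: "b \<notin> set xs"
    have "b \<in> V" using that \<open>E \<subseteq> V \<times> V\<close> by blast
    obtain i where i: "i < length xs" "a = xs ! i" using a by (auto simp: in_set_conv_nth)
    have "xs \<noteq> []" using i by auto
    have "i \<noteq> 0"
    proof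
      assume "i = 0"
      then have "(b, hd xs) \<in> E" using that i \<open>xs \<noteq> []\<close> \<open>sym E\<close> by (metis hd_conv_nth symD)
      then have "vertex_path E (b # xs)" using xs(1) b by (intro vertex_path_Cons)
      then show False using max[of "b # xs"] xs(2) \<open>b \<in> V\<close> by simp
    qed
    have "Suc i < length xs"
    proof (rule ccontr)
      assume "\<not> Suc i < length xs"
      then have "i = length xs - 1" using i by simp
      then have "(last xs, b) \<in> E" using that i \<open>xs \<noteq> []\<close> by (metis last_conv_nth)
      then have "vertex_path E (xs @ [b])" using xs(1) b by (intro vertex_path_snoc)
      then show False using max[of "xs @ [b]"] xs(2) \<open>b \<in> V\<close> by simp
    qed
    have "(a, xs ! Suc i) \<in> E" using vertex_path_nth[OF xs(1) \<open>Suc i < length xs\<close>] i by simp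
    moreover have "(a, xs ! (i - 1)) \<in> E"
      using vertex_path_nth[OF xs(1), of "i - 1"] i \<open>i \<noteq> 0\<close> \<open>sym E\<close>
      by (auto intro: symD)
    ultimately have "{xs ! Suc i, xs ! (i - 1), b} \<subseteq> E `` {a}" using that by auto
    moreover have "card {xs ! Suc i, xs ! (i - 1), b} = 3"
      using dist b \<open>Suc i < length xs\<close> \<open>i \<noteq> 0\<close>
      by (auto simp: card_insert_if nth_eq_iff_index_eq)
    moreover have "finite (E `` {a})"
      using \<open>finite V\<close> \<open>E \<subseteq> V \<times> V\<close> by (auto intro: finite_subset[of _ V])
    ultimately have "3 \<le> card (E `` {a})" by (metis card_mono)
    moreover have "a \<in> V" using that xs(2) by blast
    ultimately show False using deg[of a] by simp
  qed
  have "V \<subseteq> set xs"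
  proof
    fix v assume "v \<in> V"
    then have "xs \<noteq> []" using max[of "[v]"] by (auto simp: vertex_path_def)
    then have "(hd xs, v) \<in> E\<^sup>*" using conn \<open>v \<in> V\<close> xs(2) by (meson hd_in_set subsetD)
    then show "v \<in> set xs"
      using \<open>xs \<noteq> []\<close> closed by (induction rule: rtrancl_induct) auto
  qed
  with xs(2) have V: "V = set xs" by blast
  have "E = {(xs ! i, xs ! j) | i j.
       i < length xs \<and> j < length xs \<and> (j = Suc i \<or> i = Suc j)}" (is "E = ?P")
  proof
    show "E \<subseteq> ?P"
    proof
      fix e assume "e \<in> E"
      moreover obtain a b where e: "e = (a, b)" by fastforce
      ultimately have ab: "(a, b) \<in> E" "(b, a) \<in> E" "a \<in> set xs" "b \<in> set xs"
        using \<open>E \<subseteq> V \<times> V\<close> \<open>sym E\<close> V by (auto simp: sym_def)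
      then obtain i j where ij: "i < length xs" "a = xs ! i" "j < length xs" "b = xs ! j"
        by (metis in_set_conv_nth)
      have "i \<noteq> j" using ab ij \<open>irrefl E\<close> by (auto simp: irrefl_def)
      then have "j = Suc i \<or> i = Suc j"
        using vertex_path_chordless[OF \<open>cycle_free E\<close> \<open>sym E\<close> xs(1)] ab ij by (metis nat_neq_iff)
      then show "e \<in> ?P" using e ij by blast
    qed
    show "?P \<subseteq> E"
      using vertex_path_nth[OF xs(1)] \<open>sym E\<close> by (auto intro: symD)
  qed
  with dist V show ?thesis by (rule that)
qed

section \<open>Undirected pair graphs\<close>

lemma pair_graph_rel:
  assumes "pair_graph G"
  shows "finite (pverts G)" "parcs G \<subseteq> pverts G \<times> pverts G" "sym (parcs G)" "irrefl (parcs G)"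
proof -
  interpret pair_graph G by fact
  show "finite (pverts G)" by (rule pair_finite_verts)
  show "parcs G \<subseteq> pverts G \<times> pverts G" using in_arcsD1 in_arcsD2 by auto
  show "sym (parcs G)" using arcs_symmetric by (auto intro: symI)
  show "irrefl (parcs G)" using no_loops' by (auto simp: irrefl_def)
qed

lemma degree_eq_card_Image: "degree G v = card (parcs G `` {v})"
proof -
  have "out_arcs (with_proj G) v = Pair v ` (parcs G `` {v})" by auto
  then show ?thesis by (simp add: out_degree_def card_image inj_on_def)
qed

text \<open>Every undirected edge is a pair of opposite arcs, so this is the handshake lemma.\<close>

lemma sum_degree_eq_card_arcs:
  assumes "pair_graph G"
  shows "(\<Sum>v\<in>pverts G. degree G v) = card (parcs G)"
proof -
  note rel = pair_graph_rel[OF assms]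
  have "parcs G = (SIGMA v:pverts G. parcs G `` {v})" using rel(2) by auto
  moreover have "finite (parcs G `` {v})" for v
    using rel(1,2) by (auto intro: finite_subset[of _ "pverts G"])
  ultimately have "card (parcs G) = (\<Sum>v\<in>pverts G. card (parcs G `` {v}))"
    using rel(1) by (metis card_SigmaI)
  then show ?thesis by (simp only: degree_eq_card_Image)
qed

text \<open>The arc list that traverses \<open>xs\<close> and then steps to \<open>v\<close>. Cycles arise with \<open>v = hd xs\<close>, but the
  induction removes the head of \<open>xs\<close> and so needs a target of its own.\<close>

lemma closing_walk:
  assumes "xs \<noteq> []"
  shows "pcas (hd xs) (zip xs (tl xs @ [v])) v"
    and "pawalk_verts (hd xs) (zip xs (tl xs @ [v])) = xs @ [v]"
    and "set (zip xs (tl xs @ [v])) \<subseteq> E \<longleftrightarrow>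
      successively (\<lambda>x y. (x, y) \<in> E) xs \<and> (last xs, v) \<in> E"
  using assms
proof (induction xs rule: list_nonempty_induct)
  case (cons x xs)
  {
    case 1 show ?case using cons by (cases xs) auto
  next
    case 2 show ?case using cons by (cases xs) auto
  next
    case 3 show ?case using cons by (cases xs) auto
  }
qed auto

lemma undirected_forest_cycle_free:
  assumes "undirected_forest G"
  shows "cycle_free (parcs G)"
  unfolding cycle_free_def
proof
  assume "\<exists>xs. vertex_path (parcs G) xs \<and> 3 \<le> length xs \<and> (last xs, hd xs) \<in> parcs G"
  then obtain xs where xs: "vertex_path (parcs G) xs" "3 \<le> length xs" "(last xs, hd xs) \<in> parcs G"
    by blast
  have "pair_graph G" using assms by (simp add: undirected_forest_def)
  then interpret pair_graph G .
  define p where "p = zip xs (tl xs @ [hd xs])"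
  have "xs \<noteq> []" using xs(2) by auto
  note walk = closing_walk[OF this, of "hd xs", folded p_def]
  have "awalk (hd xs) p (hd xs)"
    using walk(1,3) xs in_arcsD2 by (auto simp: awalk_def vertex_path_def)
  moreover have "distinct (tl (pawalk_verts (hd xs) p))"
    using walk(2) xs(1) \<open>xs \<noteq> []\<close> by (cases xs) (auto simp: vertex_path_def)
  moreover have "3 \<le> length p" using xs(2) by (simp add: p_def)
  ultimately have "undirected_cycle G p"
    by (auto simp: undirected_cycle_def cycle_def)
  with assms show False by (auto simp: undirected_forest_def)
qed

lemma connected_pair_graph_iff:
  assumes "pair_graph G"
  shows "connected (with_proj G) \<longleftrightarrow>
    pverts G \<noteq> {} \<and> (\<forall>u\<in>pverts G. \<forall>v\<in>pverts G. (u, v) \<in> (parcs G)\<^sup>*)"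
proof -
  interpret pair_graph G by fact
  have "(parcs G)\<^sup>s = parcs G" using arcs_symmetric by (auto simp: symcl_def)
  then show ?thesis
    using reachable_conv' by (simp add: connected_conv reachable_def)
qed

text \<open>Stated over the integers, the equation fails for the empty graph, which is not connected
  either.\<close>

lemma connected_forest_iff_sum_degree:
  assumes "undirected_forest G"
  shows "connected (with_proj G) \<longleftrightarrow>
    (\<Sum>v\<in>pverts G. int (degree G v)) = 2 * int (card (pverts G)) - 2"
proof (cases "pverts G = {}")
  case True
  then show ?thesis by (simp add: connected_conv)
next
  case False
  have G: "pair_graph G" using assms by (simp add: undirected_forest_def)
  have "(\<Sum>v\<in>pverts G. int (degree G v)) = int (card (parcs G))"
    using sum_degree_eq_card_arcs[OF G] by (simp flip: of_nat_sum)
  moreover have "card (parcs G) + 2 = 2 * card (pverts G) \<longleftrightarrow> connected (with_proj G)"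
    using forest_card_edges[OF pair_graph_rel(1)[OF G] False pair_graph_rel(2-4)[OF G]
        undirected_forest_cycle_free[OF assms]] connected_pair_graph_iff[OF G] False
    by blast
  ultimately show ?thesis by linarith
qed

lemma path_graph_degree_le_2:
  assumes "path_graph H"
  shows "card (arcs_ends H `` {v}) \<le> 2"
proof -
  obtain xs where dist: "distinct xs" and arcs: "arcs_ends H = {(xs ! i, xs ! j) | i j.
       i < length xs \<and> j < length xs \<and> (j = Suc i \<or> i = Suc j)}"
    using assms unfolding path_graph_def by (elim exE conjE) (rule that)
  show ?thesis
  proof (cases "v \<in> set xs")
    case True
    then obtain k where "k < length xs" "v = xs ! k" by (auto simp: in_set_conv_nth)
    then have "arcs_ends H `` {v} \<subseteq> {xs ! Suc k, xs ! (k - 1)}"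
      using dist by (auto simp: arcs nth_eq_iff_index_eq)
    then have "card (arcs_ends H `` {v}) \<le> card {xs ! Suc k, xs ! (k - 1)}"
      by (rule card_mono[rotated]) simp
    also have "\<dots> \<le> 2" by (simp add: card_insert_if)
    finally show ?thesis .
  next
    case False
    then have "arcs_ends H `` {v} = {}" by (auto simp: arcs)
    then show ?thesis by simp
  qed
qed

lemma arcs_ends_induce_with_proj:
  "arcs_ends (with_proj G \<restriction> X) = parcs G \<inter> X \<times> X"
  by (auto simp: arcs_ends_conv)

text \<open>Every neighbour \<open>w\<close> has degree at least one, so \<open>1 < degree G w\<close> means that \<open>w\<close> is not a leaf,
  and for a non-leaf \<open>v\<close> the counted set is its neighbourhood in the subgraph on the non-leaves.\<close>

lemma caterpillar_iff:
  assumes "undirected_tree G"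
  shows "caterpillar G \<longleftrightarrow>
    (\<forall>v\<in>pverts G. card {w. (v, w) \<in> parcs G \<and> 1 < degree G w} \<le> 2)"
proof -
  have forest: "undirected_forest G" and G: "pair_graph G"
    using assms by (auto simp: undirected_tree_def undirected_forest_def)
  note rel = pair_graph_rel[OF G]
  define N where "N = {v \<in> pverts G. \<not> leaf G v}"
  define E where "E = parcs G \<inter> N \<times> N"
  have fin: "finite (parcs G `` {v})" for v
    using rel(1,2) by (auto intro: finite_subset[of _ "pverts G"])
  have inner: "1 < degree G w \<longleftrightarrow> w \<in> N" if "(v, w) \<in> parcs G" for v w
  proof -
    have "v \<in> parcs G `` {w}" "w \<in> pverts G" using that rel(2,3) by (auto simp: sym_def)
    then have "degree G w \<noteq> 0" using fin[of w] by (auto simp: degree_eq_card_Image)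
    then show ?thesis using \<open>w \<in> pverts G\<close> by (auto simp: N_def leaf_def)
  qed
  then have inner_nbrs: "{w. (v, w) \<in> parcs G \<and> 1 < degree G w} = E `` {v}" if "v \<in> N" for v
    using that by (auto simp: E_def)
  have "path_graph (with_proj G \<restriction> N) \<longleftrightarrow>
    (\<forall>v\<in>pverts G. card {w. (v, w) \<in> parcs G \<and> 1 < degree G w} \<le> 2)" (is "_ \<longleftrightarrow> ?deg")
  proof
    assume path: "path_graph (with_proj G \<restriction> N)"
    show ?deg
    proof
      fix v assume v: "v \<in> pverts G"
      show "card {w. (v, w) \<in> parcs G \<and> 1 < degree G w} \<le> 2"
      proof (cases "v \<in> N")
        case True
        then show ?thesis
          using path_graph_degree_le_2[OF path, of v] inner_nbrs[OF True]
          by (simp add: arcs_ends_induce_with_proj E_def)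
      next
        case False
        then have "card (parcs G `` {v}) = 1"
          using v by (simp add: N_def leaf_def degree_eq_card_Image)
        moreover have "card {w. (v, w) \<in> parcs G \<and> 1 < degree G w} \<le> card (parcs G `` {v})"
          using fin by (intro card_mono) auto
        ultimately show ?thesis by simp
      qed
    qed
  next
    assume deg: ?deg
    obtain xs where "distinct xs" "N = set xs"
      "E = {(xs ! i, xs ! j) | i j. i < length xs \<and> j < length xs \<and> (j = Suc i \<or> i = Suc j)}"
    proof (rule path_graph_if_degree_le_2[of N E])
      show "finite N" "E \<subseteq> N \<times> N" using rel(1) by (auto simp: N_def E_def)
      show "sym E" "irrefl E" using rel(3,4) by (auto simp: E_def sym_def irrefl_def)
      show "cycle_free E"
        using undirected_forest_cycle_free[OF forest] by (rule cycle_free_subset) (simp add: E_def)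
      show "card (E `` {v}) \<le> 2" if "v \<in> N" for v
        using deg inner_nbrs[OF that] that by (auto simp: N_def)
      show "(u, v) \<in> E\<^sup>*" if "u \<in> N" "v \<in> N" for u v
      proof -
        let ?L = "{v. leaf G v}"
        have "(u, v) \<in> (parcs G)\<^sup>*"
          using assms that connected_pair_graph_iff[OF G] by (auto simp: undirected_tree_def N_def)
        moreover have "y = z" if "x \<in> ?L" "(x, y) \<in> parcs G" "(x, z) \<in> parcs G" for x y z
        proof -
          have "card (parcs G `` {x}) = 1"
            using that(1) by (simp add: leaf_def degree_eq_card_Image)
          then obtain w where "parcs G `` {x} = {w}" by (auto simp: card_1_singleton_iff)
          then show ?thesis using that(2,3) by (metis Image_singleton_iff singletonD)
        qed
        ultimately have "(u, v) \<in> (parcs G \<inter> (- ?L) \<times> (- ?L))\<^sup>*"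
          using that rel(3) by (intro rtrancl_avoiding_leaves) (auto simp: N_def)
        moreover have "parcs G \<inter> (- ?L) \<times> (- ?L) = E"
          using rel(2) by (auto simp: E_def N_def)
        ultimately show ?thesis by simp
      qed
    qed
    then show "path_graph (with_proj G \<restriction> N)"
      by (auto simp only: path_graph_def induce_subgraph_verts arcs_ends_induce_with_proj E_def)
  qed
  then show ?thesis using assms by (simp add: caterpillar_def N_def)
qed

section \<open>Realizations\<close>

lemma size_neighbour_degrees: "size (neighbour_degrees G v) = degree G v"
  by (simp add: neighbour_degrees_def degree_eq_card_Image Image_def)

lemma size_large_neighbour_degrees:
  assumes "pair_graph G"
  shows "size {#l \<in># neighbour_degrees G v. 1 < l#} =
    card {w. (v, w) \<in> parcs G \<and> 1 < degree G w}"
proof -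
  have "finite {w. (v, w) \<in> parcs G}"
    using pair_graph_rel(1,2)[OF assms] by (auto intro: finite_subset[of _ "pverts G"])
  then show ?thesis
    by (simp add: neighbour_degrees_def filter_mset_image_mset filter_mset_mset_set)
qed

text \<open>For one fixed realization the theorem already holds; quantifying over realizations gives the
  general form.\<close>

lemma caterpillar_realization_iff:
  assumes "realization G n S"
  shows "caterpillar G \<longleftrightarrow> undirected_forest G \<and>
    (\<Sum>i=1..n. int (size (S i))) = 2 * int n - 2 \<and>
    \<not> (\<exists>i\<in>{1..n}. size {#l \<in># S i. l > 1#} > 2)"
proof (cases "undirected_forest G")
  case False
  then show ?thesis by (simp add: caterpillar_def undirected_tree_def)
next
  case True
  have G: "pair_graph G" and V: "pverts G = {1..n}"
    and S: "\<And>i. i \<in> {1..n} \<Longrightarrow> S i = neighbour_degrees G i"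
    using assms by (auto simp: realization_def)
  have "(\<Sum>i=1..n. int (size (S i))) = (\<Sum>v\<in>pverts G. int (degree G v))"
    unfolding V by (rule sum.cong) (simp_all add: S size_neighbour_degrees)
  then have "(\<Sum>i=1..n. int (size (S i))) = 2 * int n - 2 \<longleftrightarrow> undirected_tree G"
    using connected_forest_iff_sum_degree[OF True] True by (simp add: V undirected_tree_def)
  moreover have "(\<forall>i\<in>{1..n}. size {#l \<in># S i. l > 1#} \<le> 2) \<longleftrightarrow>
      (\<forall>v\<in>pverts G. card {w. (v, w) \<in> parcs G \<and> 1 < degree G w} \<le> 2)"
    unfolding V
    by (rule ball_cong) (simp_all only: S size_large_neighbour_degrees[OF G])
  moreover have "caterpillar G \<longrightarrow> undirected_tree G" by (simp add: caterpillar_def)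
  ultimately show ?thesis
    using caterpillar_iff[of G] True by (simp only: bex_simps not_less) argo
qed

theorem theorem15:
  fixes n :: nat and S :: "nat \<Rightarrow> stub_star"
  assumes "ensemble n S"
  shows "(\<exists>G. realization G n S \<and> caterpillar G) \<longleftrightarrow>
    forest_realizable n S \<and>
    (\<Sum>i=1..n. int (size (S i))) = 2 * int n - 2 \<and>
    \<not> (\<exists>i\<in>{1..n}. size {#l \<in># S i. l > 1#} > 2)"
  unfolding forest_realizable_def using caterpillar_realization_iff by blast

end
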